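(* Let $q>2$ be a prime power, let $s\ge 2$ and $t\ge 2$ be integers, and put $m=s+t$. Let $\phi:\mathbb{F}_q^s\to\mathbb{F}_q^t$ and $g:\mathbb{F}_q^s\to\mathbb{F}_q$ be functions, and let $f:\mathbb{F}_q^m=\mathbb{F}_q^s\oplus\mathbb{F}_q^t\to\mathbb{F}_q$ be given by $f(\beta,\gamma)=\phi(\beta)\cdot\gamma+g(\beta)$ for $\beta\in\mathbb{F}_q^s$, $\gamma\in\mathbb{F}_q^t$. Let $U=\{\beta\in\mathbb{F}_q^s : \mathrm{wt}(\beta)\le 1\}$. Suppose that (1) $\phi$ is an injection from $U$ to $\mathbb{F}_q^t\setminus\{\mathbf{0}\}$ (i.e. the restriction of $\phi$ to $U$ is injective and takes values in $\mathbb{F}_q^t\setminus\{\mathbf{0}\}$); (2) there is $c\in\mathbb{F}_q^*$ such that $g(\beta)=c$ for all $\beta\in\mathbb{F}_q^s$. Then $\mathcal{C}_f$ is a $[q^m-1,m+1]_q$ minimal linear code.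
   Context: $\mathrm{wt}$ denotes the Hamming weight (number of nonzero coordinates), and $\mathbf{x}\cdot\mathbf{y}=\sum_i x_iy_i$. For $f:\mathbb{F}_q^m\to\mathbb{F}_q$, $\mathcal{C}_f=\{(uf(\alpha)+\mathbf{v}\cdot\alpha)_{\alpha\in\mathbb{F}_q^m\setminus\{\mathbf{0}\}} : u\in\mathbb{F}_q,\ \mathbf{v}\in\mathbb{F}_q^m\}\subseteq\mathbb{F}_q^{q^m-1}$. An $[n,k]_q$ linear code is a $k$-dimensional subspace of $\mathbb{F}_q^n$. The support of a vector is the set of its coordinate positions with nonzero entry. A codeword $\mathbf{c}$ of a linear code $\mathcal{C}$ is minimal if every $\mathbf{b}\in\mathcal{C}$ whose support is contained in the support of $\mathbf{c}$ equals $a\mathbf{c}$ for some $a\in\mathbb{F}_q$; the code $\mathcal{C}$ is minimal if all of its codewords are minimal. *)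

theory Defs
  imports "HOL-Analysis.Analysis"
begin

text \<open>
  The field \<open>\<F>\<^sub>q\<close> is a type \<open>'a\<close> of sort \<open>{field, finite}\<close>, with \<open>q = CARD('a)\<close>. The space
  \<open>\<F>\<^sub>q\<^sup>n\<close> is \<open>'a ^ 'n\<close>, with \<open>n = CARD('n)\<close>; its subspaces and dimensions are those of the
  library's \<open>vec\<close> interpretation of vector spaces.
\<close>

definition support :: "'a::zero ^ 'n \<Rightarrow> 'n set" where
  "support x = {i. x $ i \<noteq> 0}"

definition wt :: "'a::zero ^ 'n \<Rightarrow> nat" where
  "wt x = card (support x)"

text \<open>The identification \<open>\<F>\<^sub>q\<^sup>s \<oplus> \<F>\<^sub>q\<^sup>t = \<F>\<^sub>q\<^sup>s\<^sup>+\<^sup>t\<close>, with coordinates indexed by a disjoint sum.\<close>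

definition vec_append :: "'a ^ 's \<Rightarrow> 'a ^ 't \<Rightarrow> 'a ^ ('s + 't)" where
  "vec_append \<beta> \<gamma> = (\<chi> i. case i of Inl j \<Rightarrow> \<beta> $ j | Inr k \<Rightarrow> \<gamma> $ k)"

definition linear_code :: "nat \<Rightarrow> nat \<Rightarrow> nat \<Rightarrow> ('a::{field,finite} ^ 'n) set \<Rightarrow> bool" where
  "linear_code n k q C \<longleftrightarrow>
     CARD('a) = q \<and> CARD('n) = n \<and> vec.subspace C \<and> vec.dim C = k"

definition minimal_codeword :: "('a::field ^ 'n) set \<Rightarrow> 'a ^ 'n \<Rightarrow> bool" where
  "minimal_codeword C c \<longleftrightarrow> c \<in> C \<and> (\<forall>b\<in>C. support b \<subseteq> support c \<longrightarrow> (\<exists>a. b = a *s c))"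

definition minimal_code :: "('a::field ^ 'n) set \<Rightarrow> bool" where
  "minimal_code C \<longleftrightarrow> (\<forall>c\<in>C. minimal_codeword C c)"

text \<open>
  The codewords of \<open>\<C>\<^sub>f\<close> have their coordinates indexed by \<open>\<F>\<^sub>q\<^sup>m \<setminus> {0}\<close>. Since the index set of a
  vector is a type, the nonzero vectors are made into a type.
\<close>

typedef (overloaded) ('a, 'm) nonzero_vec = "{\<alpha> :: 'a::zero_neq_one ^ 'm. \<alpha> \<noteq> 0}"
proof
  show "(\<chi> i. 1) \<in> {\<alpha> :: 'a ^ 'm. \<alpha> \<noteq> 0}"
    by (simp add: vec_eq_iff)
qed

instance nonzero_vec :: ("{zero_neq_one,finite}", finite) finite
proof
  show "finite (UNIV :: ('a, 'b) nonzero_vec set)"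
    by (rule finite_imageD [of Rep_nonzero_vec])
       (auto simp: inj_on_def Rep_nonzero_vec_inject)
qed

definition code_of :: "('a::{field,finite} ^ 'm \<Rightarrow> 'a) \<Rightarrow> ('a ^ ('a, 'm) nonzero_vec) set" where
  "code_of f =
     {(\<chi> \<alpha>. u * f (Rep_nonzero_vec \<alpha>) + scalar_product v (Rep_nonzero_vec \<alpha>)) | u v. True}"

end

theory Submission
  imports Defs
begin

text \<open>
  The codeword of \<open>(u, v)\<close> is the function \<open>u f(\<alpha>) + v \<cdot> \<alpha>\<close> on nonzero \<open>\<alpha>\<close>. Let the zeros of a
  codeword \<open>a\<close> be zeros of \<open>b\<close>.

  If \<open>a\<close> is a linear functional, then so is \<open>b\<close>: otherwise look at points \<open>(0, \<gamma>)\<close>, where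
  \<open>b\<close> has the form \<open>w \<cdot> \<gamma> + d\<close> with \<open>d \<noteq> 0\<close>. The functional \<open>a\<close> vanishes at some such point with
  \<open>\<gamma> \<noteq> 0\<close> as \<open>t \<ge> 2\<close>, hence at all its multiples, but \<open>b\<close> cannot vanish at two nonzero multiples
  of \<open>\<gamma>\<close>, which exist as \<open>q > 2\<close>.

  If \<open>a\<close> involves \<open>f\<close>, scale \<open>a\<close> to have \<open>u = 1\<close> and subtract a multiple of it from \<open>b\<close> to reduce
  to a linear functional \<open>b\<close> given by \<open>(z\<^sub>1, z\<^sub>2)\<close>, which must be shown to be zero. Over a fixed
  \<open>\<beta>\<close> in \<open>U\<close> with \<open>w \<beta> = \<phi> \<beta> + v\<^sub>2 \<noteq> 0\<close> (all but at most one), the zeros of \<open>a\<close> form an affine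
  hyperplane normal to \<open>w \<beta>\<close>, so \<open>z\<^sub>2\<close> is a multiple of \<open>w \<beta>\<close>. As \<open>\<phi>\<close> is injective on \<open>U\<close> and \<open>U\<close>
  has more than \<open>q\<close> elements, this forces \<open>z\<^sub>2 = 0\<close>, and then \<open>z\<^sub>1 \<cdot> \<beta> = 0\<close> for all these \<open>\<beta>\<close>.
\<close>

section \<open>Scalar products\<close>

lemma scalar_product_add_left: "scalar_product (x + y) z = scalar_product x z + scalar_product y z"
  by (simp add: scalar_product_def distrib_right sum.distrib)

lemma scalar_product_add_right: "scalar_product x (y + z) = scalar_product x y + scalar_product x z"
  by (simp add: scalar_product_def distrib_left sum.distrib)

lemma scalar_product_smult_left: "scalar_product (k *s x) z = k * scalar_product x z"
  by (simp add: scalar_product_def sum_distrib_left mult.assoc)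

lemma scalar_product_smult_right:
  fixes x :: "'a::comm_semiring_1 ^ 'n"
  shows "scalar_product x (k *s z) = k * scalar_product x z"
  by (simp add: scalar_product_def sum_distrib_left mult.left_commute)

lemma scalar_product_diff_left:
  fixes x :: "'a::ring_1 ^ 'n"
  shows "scalar_product (x - y) z = scalar_product x z - scalar_product y z"
  by (simp add: scalar_product_def left_diff_distrib sum_subtractf)

lemma scalar_product_zero_left [simp]: "scalar_product 0 x = 0"
  by (simp add: scalar_product_def)

lemma scalar_product_zero_right [simp]: "scalar_product x 0 = 0"
  by (simp add: scalar_product_def)

lemma scalar_product_axis [simp]: "scalar_product x (axis i k) = x $ i * k"
  by (simp add: scalar_product_def axis_def if_distrib [of "times _"] cong: if_cong)

lemmas scalar_product_linear =
  scalar_product_add_left scalar_product_add_right scalar_product_diff_left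
  scalar_product_smult_left scalar_product_smult_right

lemma scalar_product_vec_append:
  "scalar_product (vec_append x y) (vec_append x' y') = scalar_product x x' + scalar_product y y'"
  by (simp add: scalar_product_def vec_append_def sum.Plus flip: UNIV_Plus_UNIV)

lemma vec_append_cases:
  obtains x y where "\<alpha> = vec_append x y"
proof
  show "\<alpha> = vec_append (\<chi> i. \<alpha> $ Inl i) (\<chi> j. \<alpha> $ Inr j)"
    by (simp add: vec_append_def vec_eq_iff split: sum.split)
qed

lemma vec_append_eq_0_iff: "vec_append x y = 0 \<longleftrightarrow> x = 0 \<and> y = 0"
  by (auto simp: vec_append_def vec_eq_iff split: sum.splits)

lemma exists_two_elements:
  assumes "CARD('n::finite) \<ge> 2"
  obtains i j :: "'n::finite" where "i \<noteq> j"
  using assms by (metis UNIV_I card_le_Suc0_iff_eq finite not_less_eq_eq numeral_2_eq_2)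

lemma scalar_product_orthogonal_nonzero:
  fixes w :: "'a::field ^ 'n"
  assumes "CARD('n) \<ge> 2"
  obtains \<gamma> where "\<gamma> \<noteq> 0" "scalar_product w \<gamma> = 0"
proof -
  obtain i j :: 'n where "i \<noteq> j"
    using exists_two_elements [OF assms] .
  show thesis
  proof (cases "w $ i = 0")
    case True
    then show thesis
      by (intro that [of "axis i 1"]) auto
  next
    case False
    then have "(axis i (w $ j) + axis j (- (w $ i))) $ j \<noteq> 0"
      using \<open>i \<noteq> j\<close> by (simp add: axis_def)
    then have "axis i (w $ j) + axis j (- (w $ i)) \<noteq> 0"
      by (intro notI) simp
    then show thesis
      by (rule that) (simp add: scalar_product_add_right)
  qed
qed

text \<open>If \<open>w $ i\<close> is nonzero, \<open>axis i (d / w $ i)\<close> lies on the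
  hyperplane, and adding \<open>axis j 1 + axis i (- (w $ j / w $ i))\<close> does not leave it.
  Hence \<open>v\<close> annihilates these directions, which makes each \<open>v $ j\<close> the
  same multiple of \<open>w $ j\<close>.\<close>

lemma constant_on_hyperplane:
  fixes w v :: "'a::field ^ 'n"
  assumes "w \<noteq> 0" and *: "\<And>\<gamma>. scalar_product w \<gamma> = d \<Longrightarrow> scalar_product v \<gamma> = e"
  shows "\<exists>k. v = k *s w \<and> e = k * d"
proof -
  obtain i where i: "w $ i \<noteq> 0"
    using \<open>w \<noteq> 0\<close> by (auto simp: vec_eq_iff)
  define x where "x = axis i (d / w $ i)"
  have e: "e = v $ i / w $ i * d"
    using * [of x] i by (simp add: x_def)
  have "v $ j = v $ i / w $ i * w $ j" for j
  proof -
    have "scalar_product v (x + (axis j 1 + axis i (- (w $ j / w $ i)))) = e"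
      using i by (intro *) (simp add: scalar_product_add_right x_def)
    then show ?thesis
      using i e by (simp add: scalar_product_add_right x_def)
  qed
  then have "v = (v $ i / w $ i) *s w"
    unfolding vec_eq_iff vector_smult_component by blast
  with e show ?thesis
    by blast
qed

lemma exists_not_in_pair:
  fixes a b :: "'a::finite"
  assumes "CARD('a) > 2"
  obtains k where "k \<noteq> a" "k \<noteq> b"
proof -
  have "card {a, b} \<le> 2"
    by (simp add: card_insert_if)
  with assms have "{a, b} \<noteq> UNIV"
    by auto
  then show thesis
    using that by auto
qed

lemma affine_nonzero_on_hyperplane:
  fixes w v :: "'a::{field,finite} ^ 'n"
  assumes "CARD('a) > 2" "CARD('n) \<ge> 2" "d \<noteq> 0"
  obtains \<gamma> where "\<gamma> \<noteq> 0" "scalar_product w \<gamma> = 0" "scalar_product v \<gamma> + d \<noteq> 0"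
proof -
  obtain \<gamma> where \<gamma>: "\<gamma> \<noteq> 0" "scalar_product w \<gamma> = 0"
    using scalar_product_orthogonal_nonzero [OF assms(2)] .
  obtain k :: 'a where k: "k \<noteq> 0" "k \<noteq> 1"
    using exists_not_in_pair [OF assms(1)] .
  show thesis
  proof (cases "scalar_product v \<gamma> + d = 0")
    case True
    \<comment> \<open>Scaling \<open>\<gamma>\<close> preserves orthogonality to \<open>w\<close>,
      but as \<open>d\<close> is nonzero it moves the point off the zero of the affine
      function.\<close>
    then have "scalar_product v (k *s \<gamma>) + d = d * (1 - k)"
      by (simp add: scalar_product_smult_right add_eq_0_iff2 algebra_simps)
    then show thesis
      using \<gamma> k \<open>d \<noteq> 0\<close> by (intro that [of "k *s \<gamma>"]) (auto simp: scalar_product_smult_right)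
  qed (use \<gamma> that in blast)
qed

lemma wt_axis_le_1: "wt (axis i k) \<le> 1"
proof -
  have "support (axis i k) \<subseteq> {i}"
    by (auto simp: support_def axis_def split: if_splits)
  then show ?thesis
    unfolding wt_def by (metis card_mono finite.emptyI finite.insertI is_singletonI is_singleton_altdef)
qed

lemma CARD_nonzero_vec:
  "CARD(('a::{zero_neq_one,finite}, 'm::finite) nonzero_vec) = CARD('a) ^ CARD('m) - 1"
proof -
  interpret type_definition "Rep_nonzero_vec :: ('a, 'm) nonzero_vec \<Rightarrow> _" Abs_nonzero_vec "{\<alpha>. \<alpha> \<noteq> 0}"
    by (rule type_definition_nonzero_vec)
  have "{\<alpha> :: 'a ^ 'm. \<alpha> \<noteq> 0} = UNIV - {0}"
    by auto
  with card show ?thesis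
    by (simp add: card_Diff_subset)
qed

section \<open>Minimality\<close>

locale affine_on_fibres =
  fixes \<phi> :: "'a::{field,finite} ^ 's \<Rightarrow> 'a ^ 't"
    and f :: "'a ^ ('s + 't) \<Rightarrow> 'a" and c :: 'a
  assumes q: "CARD('a) > 2" and s: "CARD('s) \<ge> 2" and t: "CARD('t) \<ge> 2"
    and c: "c \<noteq> 0"
    and f: "f (vec_append \<beta> \<gamma>) = scalar_product (\<phi> \<beta>) \<gamma> + c"
    and inj: "inj_on \<phi> {\<beta>. wt \<beta> \<le> 1}"
begin

lemma nonzero_on_linear_zeros:
  assumes "u \<noteq> 0"
  shows "\<exists>\<alpha>. \<alpha> \<noteq> 0 \<and> scalar_product z \<alpha> = 0 \<and> u * f \<alpha> + scalar_product v \<alpha> \<noteq> 0"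
proof -
  obtain v1 v2 where v: "v = vec_append v1 v2" by (rule vec_append_cases)
  obtain z1 z2 where z: "z = vec_append z1 z2" by (rule vec_append_cases)
  \<comment> \<open>Over \<open>\<beta> = 0\<close> the components \<open>z1\<close> and
    \<open>v1\<close> contribute nothing.\<close>
  obtain \<gamma> where "\<gamma> \<noteq> 0" "scalar_product z2 \<gamma> = 0"
      "scalar_product (u *s \<phi> 0 + v2) \<gamma> + u * c \<noteq> 0"
    using affine_nonzero_on_hyperplane [OF q t, of "u * c"] \<open>u \<noteq> 0\<close> c by auto
  then show ?thesis
    by (intro exI [of _ "vec_append 0 \<gamma>"])
      (auto simp: v z f vec_append_eq_0_iff scalar_product_vec_append scalar_product_linear
        algebra_simps)
qed

lemma linear_vanishing_on_zeros:
  assumes zeros: "\<And>\<alpha>. \<alpha> \<noteq> 0 \<Longrightarrow> f \<alpha> + scalar_product v \<alpha> = 0 \<Longrightarrow> scalar_product z \<alpha> = 0"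
  shows "z = 0"
proof -
  obtain v1 v2 where v: "v = vec_append v1 v2" by (rule vec_append_cases)
  obtain z1 z2 where z: "z = vec_append z1 z2" by (rule vec_append_cases)
  define w where "w \<beta> = \<phi> \<beta> + v2" for \<beta>
  have w_eqD: "x = y" if "w x = w y" "wt x \<le> 1" "wt y \<le> 1" for x y
    using that inj by (auto simp: w_def inj_on_def)
  have slice: "\<exists>k. z2 = k *s w \<beta> \<and> - scalar_product z1 \<beta> = k * - (c + scalar_product v1 \<beta>)"
    if "w \<beta> \<noteq> 0" for \<beta>
  proof (rule constant_on_hyperplane [OF that])
    fix \<gamma> assume \<gamma>: "scalar_product (w \<beta>) \<gamma> = - (c + scalar_product v1 \<beta>)"
    \<comment> \<open>At the origin the equation for \<open>\<gamma>\<close> would read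
      \<open>0 = - c\<close>.\<close>
    have "vec_append \<beta> \<gamma> \<noteq> 0"
      using \<gamma> c by (auto simp: vec_append_eq_0_iff)
    moreover have "f (vec_append \<beta> \<gamma>) + scalar_product v (vec_append \<beta> \<gamma>) = 0"
      using \<gamma> by (simp add: f v scalar_product_vec_append w_def scalar_product_add_left algebra_simps)
    ultimately have "scalar_product z (vec_append \<beta> \<gamma>) = 0"
      by (rule zeros)
    then show "scalar_product z2 \<gamma> = - scalar_product z1 \<beta>"
      by (simp add: z scalar_product_vec_append add_eq_0_iff)
  qed
  have z2: "z2 = 0"
  proof (rule ccontr)
    assume "z2 \<noteq> 0"
    \<comment> \<open>Otherwise the slice over 0 gives \<open>k * c = 0\<close>, so
      \<open>k = 0\<close> and \<open>z2 = 0\<close>. By injectivity, \<open>w\<close> is then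
      nonzero at every other point of weight at most 1.\<close>
    have w0: "w 0 = 0"
      using slice [of 0] c \<open>z2 \<noteq> 0\<close> by auto
    have "w (axis i a) \<noteq> 0" if "a \<noteq> 0" for i a
      using w_eqD [of "axis i a" 0] that w0 wt_axis_le_1 by (auto simp: wt_def support_def)
    then have "\<exists>k. z2 = k *s w (axis i a)" if "a \<noteq> 0" for i a
      using slice that by blast
    then have "\<forall>i a. \<exists>k. a \<noteq> 0 \<longrightarrow> z2 = k *s w (axis i a)"
      by blast
    then obtain K where K: "\<And>i a. a \<noteq> 0 \<Longrightarrow> z2 = K i a *s w (axis i a)"
      by metis
    have K0: "K i a \<noteq> 0" if "a \<noteq> 0" for i a
      using K [OF that, of i] \<open>z2 \<noteq> 0\<close> by auto
    have K_eqD: "axis i a = axis j b" if "K i a = K j b" "a \<noteq> 0" "b \<noteq> 0" for i j a b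
    proof (rule w_eqD)
      have "K i a *s w (axis i a) = K i a *s w (axis j b)"
        using K that by metis
      then show "w (axis i a) = w (axis j b)"
        using K0 that by simp
    qed (rule wt_axis_le_1)+
    obtain i j :: 's where "i \<noteq> j"
      using exists_two_elements [OF s] .
    \<comment> \<open>Counting: the nonzero multiples of a single axis vector already use up all
      nonzero coefficients, so a point on a second axis must share its coefficient with one of
      them.\<close>
    have "inj_on (K i) (UNIV - {0})"
      using K_eqD by (auto simp: inj_on_def axis_eq_axis)
    then have "K i ` (UNIV - {0}) = UNIV - {0}"
      using K0 by (intro endo_inj_surj) auto
    then have "K j 1 \<in> K i ` (UNIV - {0})"
      using K0 by simp
    then obtain a where "K j 1 = K i a" "a \<in> UNIV - {0}"
      by (rule imageE)
    then have "axis i a = axis j 1" "a \<noteq> 0"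
      using K_eqD [of i a j 1] by simp_all
    with \<open>i \<noteq> j\<close> show False
      by (simp add: axis_eq_axis)
  qed
  have z1: "scalar_product z1 \<beta> = 0" if w\<beta>: "w \<beta> \<noteq> 0" for \<beta>
  proof -
    obtain k where "z2 = k *s w \<beta>" and k: "- scalar_product z1 \<beta> = k * - (c + scalar_product v1 \<beta>)"
      using slice [OF w\<beta>] by blast
    then have "k = 0"
      using z2 w\<beta> by simp
    with k show ?thesis
      by simp
  qed
  have "z1 $ i = 0" for i
  proof -
    obtain k :: 'a where k: "k \<noteq> 0" "k \<noteq> 1"
      using exists_not_in_pair [OF q] .
    \<comment> \<open>Two points on the same axis suffice, since \<open>w\<close> vanishes at no
      more than one of them.\<close>
    have "w (axis i k) \<noteq> w (axis i 1)"
      using w_eqD [OF _ wt_axis_le_1 wt_axis_le_1, of i k i 1] k by (auto simp: axis_eq_axis)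
    then consider "w (axis i k) \<noteq> 0" | "w (axis i 1) \<noteq> 0"
      by fastforce
    then show ?thesis
      using z1 [of "axis i k"] z1 [of "axis i 1"] k by cases simp_all
  qed
  then have "z1 = 0"
    by (simp add: vec_eq_iff)
  with z2 show ?thesis
    by (simp add: z vec_append_eq_0_iff)
qed

text \<open>Phrased for parameters instead of codewords, so that it yields minimality and also, from
  zero parameters, the injectivity of \<open>encode\<close>.\<close>

lemma zeros_subset_imp_multiple:
  assumes zeros: "\<And>\<alpha>. \<alpha> \<noteq> 0 \<Longrightarrow> u * f \<alpha> + scalar_product v \<alpha> = 0 \<Longrightarrow>
      u' * f \<alpha> + scalar_product v' \<alpha> = 0"
  shows "\<exists>k. u' = k * u \<and> v' = k *s v"
proof (cases "u = 0")
  case True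
  with zeros nonzero_on_linear_zeros [of u' v v'] have u': "u' = 0"
    by auto
  show ?thesis
  proof (cases "v = 0")
    case True
    have "scalar_product v' (axis i 1) = 0" for i
      using zeros [of "axis i 1"] True u' \<open>u = 0\<close> by simp
    then have "v' = 0"
      by (simp add: vec_eq_iff)
    with True u' \<open>u = 0\<close> show ?thesis
      by simp
  next
    case False
    have "scalar_product v' \<alpha> = 0" if "scalar_product v \<alpha> = 0" for \<alpha>
      using zeros [of \<alpha>] that u' \<open>u = 0\<close> by (cases "\<alpha> = 0") auto
    with constant_on_hyperplane [OF False, of 0 v' 0] u' \<open>u = 0\<close> show ?thesis
      by auto
  qed
next
  case False
  \<comment> \<open>Subtracting this multiple cancels the \<open>f\<close> term.\<close>
  define k where "k = u' / u"
  have "v' - k *s v = 0"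
  proof (rule linear_vanishing_on_zeros)
    fix \<alpha> :: "'a ^ ('s + 't)"
    assume "\<alpha> \<noteq> 0" and \<alpha>: "f \<alpha> + scalar_product ((1 / u) *s v) \<alpha> = 0"
    have eq: "u * f \<alpha> + scalar_product v \<alpha> = 0"
      using \<alpha> False by (simp add: scalar_product_smult_left field_simps)
    have "u' * f \<alpha> + scalar_product v' \<alpha> = 0"
      using zeros \<open>\<alpha> \<noteq> 0\<close> eq by blast
    moreover have "u' * f \<alpha> + k * scalar_product v \<alpha> = k * (u * f \<alpha> + scalar_product v \<alpha>)"
      using False by (simp add: k_def field_simps)
    ultimately show "scalar_product (v' - k *s v) \<alpha> = 0"
      using eq by (simp add: scalar_product_diff_left scalar_product_smult_left add_eq_0_iff)
  qed
  moreover have "u' = k * u"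
    using False by (simp add: k_def)
  ultimately show ?thesis
    by auto
qed

lemma minimal_code_of: "minimal_code (code_of f)"
  unfolding minimal_code_def minimal_codeword_def
proof (intro ballI conjI impI)
  fix a b :: "'a ^ ('a, 's + 't) nonzero_vec"
  assume "a \<in> code_of f" "b \<in> code_of f" and supp: "support b \<subseteq> support a"
  then obtain u v u' v' where
    a: "a = (\<chi> \<alpha>. u * f (Rep_nonzero_vec \<alpha>) + scalar_product v (Rep_nonzero_vec \<alpha>))" and
    b: "b = (\<chi> \<alpha>. u' * f (Rep_nonzero_vec \<alpha>) + scalar_product v' (Rep_nonzero_vec \<alpha>))"
    by (auto simp: code_of_def)
  have "\<exists>k. u' = k * u \<and> v' = k *s v"
  proof (rule zeros_subset_imp_multiple)
    fix \<alpha> :: "'a ^ ('s + 't)"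
    assume "\<alpha> \<noteq> 0" and "u * f \<alpha> + scalar_product v \<alpha> = 0"
    then show "u' * f \<alpha> + scalar_product v' \<alpha> = 0"
      using supp Abs_nonzero_vec_inverse [of \<alpha>]
      by (auto simp: a b support_def subset_iff dest: spec [of _ "Abs_nonzero_vec \<alpha>"])
  qed
  then obtain k where "u' = k * u" "v' = k *s v"
    by blast
  then have "b $ \<alpha> = (k *s a) $ \<alpha>" for \<alpha>
    by (simp add: a b scalar_product_smult_left algebra_simps)
  then have "b = k *s a"
    unfolding vec_eq_iff by blast
  then show "\<exists>k. b = k *s a" ..
qed

section \<open>Dimension\<close>

text \<open>The parameters \<open>(u, v)\<close> are encoded as one vector, with \<open>u\<close> at the extra coordinate.\<close>

definition encode :: "'a ^ ('s + 't) option \<Rightarrow> 'a ^ ('a, 's + 't) nonzero_vec" where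
  "encode x = (\<chi> \<alpha>. x $ None * f (Rep_nonzero_vec \<alpha>) +
     scalar_product (\<chi> i. x $ Some i) (Rep_nonzero_vec \<alpha>))"

lemma linear_encode: "Vector_Spaces.linear (*s) (*s) encode"
proof -
  have "encode (x + y) = encode x + encode y" for x y
    by (simp add: encode_def vec_eq_iff scalar_product_def sum.distrib algebra_simps)
  moreover have "encode (k *s x) = k *s encode x" for k x
    by (simp add: encode_def vec_eq_iff scalar_product_def sum_distrib_left algebra_simps)
  ultimately show ?thesis
    by (simp add: Vector_Spaces.linear_iff vec.vector_space_axioms)
qed

lemma inj_encode: "inj encode"
proof (rule vec.linear_inj_iff_eq_0 [OF linear_encode, THEN iffD2], intro allI impI)
  fix x assume "encode x = 0"
  then have *: "x $ None * f \<alpha> + scalar_product (\<chi> i. x $ Some i) \<alpha> = 0" if "\<alpha> \<noteq> 0" for \<alpha>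
  proof -
    have "encode x $ Abs_nonzero_vec \<alpha> = 0"
      using \<open>encode x = 0\<close> by simp
    then show ?thesis
      using that by (simp add: encode_def Abs_nonzero_vec_inverse)
  qed
  \<comment> \<open>The pair \<open>(0, 0)\<close> vanishes everywhere, and so does the pair encoded
    by \<open>x\<close>; multiples of zero are zero.\<close>
  then have "\<exists>k. x $ None = k * 0 \<and> (\<chi> i. x $ Some i) = k *s (0 :: 'a ^ ('s + 't))"
    by (intro zeros_subset_imp_multiple)
  then have "x $ None = 0" and "\<And>i. x $ Some i = 0"
    by (auto simp: vec_eq_iff)
  then show "x = 0"
    by (metis option.exhaust vec_eq_iff zero_index)
qed

lemma range_encode: "range encode = code_of f"
proof (intro equalityI subsetI)
  fix a assume "a \<in> code_of f"
  then obtain u v where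
    "a = (\<chi> \<alpha>. u * f (Rep_nonzero_vec \<alpha>) + scalar_product v (Rep_nonzero_vec \<alpha>))"
    by (auto simp: code_of_def)
  then have "a = encode (\<chi> i. case i of None \<Rightarrow> u | Some j \<Rightarrow> v $ j)"
    by (simp add: encode_def scalar_product_def)
  then show "a \<in> range encode"
    by blast
qed (auto simp: encode_def code_of_def)

lemma linear_code_of:
  "linear_code (CARD('a) ^ (CARD('s) + CARD('t)) - 1) (CARD('s) + CARD('t) + 1) CARD('a) (code_of f)"
proof -
  have "vec.subspace (code_of f)"
    unfolding range_encode [symmetric]
    by (rule vec.linear_subspace_image [OF linear_encode vec.subspace_UNIV])
  \<comment> \<open>An injective linear map preserves dimension; the coordinate \<open>None\<close>
    accounts for the extra 1.\<close>
  moreover have "vec.dim (code_of f) = CARD(('s + 't) option)"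
    unfolding range_encode [symmetric] vec_dim_card [symmetric, where 'a = 'a]
    using inj_encode by (intro vec.dim_image_eq [OF linear_encode]) (auto intro: inj_on_subset)
  ultimately show ?thesis
    by (simp add: linear_code_def CARD_nonzero_vec)
qed

end

theorem theorem6p2:
  fixes \<phi> :: "'a::{field,finite} ^ 's \<Rightarrow> 'a ^ 't"
    and g :: "'a ^ 's \<Rightarrow> 'a"
    and f :: "'a ^ ('s + 't) \<Rightarrow> 'a"
    and U :: "('a ^ 's) set"
    and q s t m :: nat
  assumes "q = CARD('a)" and "s = CARD('s)" and "t = CARD('t)"
    and "q > 2" and "s \<ge> 2" and "t \<ge> 2" and "m = s + t"
    and "\<And>\<beta> \<gamma>. f (vec_append \<beta> \<gamma>) = scalar_product (\<phi> \<beta>) \<gamma> + g \<beta>"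
    and "U = {\<beta>. wt \<beta> \<le> 1}"
    and "inj_on \<phi> U" and "\<phi> ` U \<subseteq> UNIV - {0}"
    and "\<exists>c. c \<noteq> 0 \<and> (\<forall>\<beta>. g \<beta> = c)"
  shows "linear_code (q ^ m - 1) (m + 1) q (code_of f) \<and> minimal_code (code_of f)"
proof -
  obtain c where "c \<noteq> 0" "\<And>\<beta>. g \<beta> = c"
    using assms(12) by blast
  then interpret affine_on_fibres \<phi> f c
    using assms by unfold_locales auto
  show ?thesis
    using linear_code_of minimal_code_of assms(1-3,7) by simp
qed

end
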